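(* Let $d$ and $k$ be integers with $1\le k\le d-1$. There is a constant $C=C(d,k)$ such that for every $d$-dimensional lattice $\Lambda\subseteq\mathbb{R}^d$ with $\lambda_d(\Lambda,B^d)\le1$, writing $\lambda_i=\lambda_i(\Lambda,B^d)$, the set $\Lambda\cap B^d$ can be covered by at most $C(\lambda_k\cdots\lambda_d)^{-1}$ $k$-dimensional linear subspaces of $\mathbb{R}^d$.
   Context: $B^d$ is the closed unit Euclidean ball in $\mathbb{R}^d$ centered at the origin. A $d$-dimensional lattice is the set of all integer linear combinations of $d$ linearly independent vectors of $\mathbb{R}^d$. For a lattice $\Lambda$ and a compact convex body $K$ symmetric about the origin, the $i$th successive minimum is $\lambda_i(\Lambda,K)=\inf\{\lambda\in\mathbb{R}:\dim(\Lambda\cap(\lambda K))\ge i\}$. *)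

theory Defs
  imports "HOL-Analysis.Analysis"
begin

text \<open>A full-rank lattice in a Euclidean space: all integer linear combinations of
  DIM('a) linearly independent vectors.\<close>
definition is_lattice :: "'a::euclidean_space set \<Rightarrow> bool" where
  "is_lattice L \<longleftrightarrow>
     (\<exists>B. independent B \<and> card B = DIM('a) \<and>
          L = {x. \<exists>c. (\<forall>b\<in>B. c b \<in> \<int>) \<and> x = (\<Sum>b\<in>B. c b *\<^sub>R b)})"

text \<open>The i-th successive minimum of L with respect to K:
  inf of the (positive) scalars t with dim (L \<inter> tK) \<ge> i, where dim is the
  dimension of the linear span.\<close>
definition succ_min :: "'a::euclidean_space set \<Rightarrow> 'a set \<Rightarrow> nat \<Rightarrow> real" where
  "succ_min L K i = Inf {t. t > 0 \<and> dim (L \<inter> ((*\<^sub>R) t ` K)) \<ge> i}"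

end

theory Submission
  imports Defs
begin

text \<open>
  Choose lattice vectors \<open>v 0, \<dots>, v (d - 1)\<close> greedily, each at most twice as long as the
  shortest lattice vector outside the span \<open>U j\<close> of its predecessors; then
  \<open>\<lambda>\<^sub>j\<^sub>+\<^sub>1 \<le> 2 |v j|\<close>. By Dirichlet's simultaneous approximation theorem, a lattice point
  outside \<open>U j\<close> has distance at least \<open>c |v j|\<close> from \<open>U j\<close>, with \<open>c\<close> depending only on \<open>d\<close>.
  Two consequences for the coordinates with respect to the basis \<open>v\<close>: the \<open>j\<close>-th coordinate
  of \<open>x\<close> is at most \<open>K |x| / |v j|\<close>, and two lattice points whose coordinates \<open>k - 1, \<dots>, d - 1\<close>
  differ by less than \<open>c\<close> have equal such coordinates. Rounding these coordinates to multiples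
  of \<open>c\<close> sorts the lattice points of the unit ball into at most \<open>\<Prod>\<^sub>j\<^sub>\<ge>\<^sub>k O(1/\<lambda>\<^sub>j)\<close> classes,
  and each class lies in the \<open>k\<close>-dimensional subspace spanned by \<open>U (k - 1)\<close> and any member.
\<close>

lemma scaleR_image_cball_0:
  fixes t :: real
  assumes "t > 0"
  shows "(*\<^sub>R) t ` cball 0 1 = cball (0::'a::real_normed_vector) t"
  using cball_scale[of t 0 1] assms by simp

lemma span_insert_eq_if_diff_in_span:
  assumes "x - y \<in> span S"
  shows "span (insert x S) = span (insert y S)"
proof -
  have le: "span (insert x S) \<subseteq> span (insert y S)" if "x - y \<in> span S" for x y
  proof (rule span_minimal[OF _ subspace_span])
    have "x - y \<in> span (insert y S)"
      using that span_mono[of S "insert y S"] by blast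
    then have "y + (x - y) \<in> span (insert y S)"
      by (rule span_add[OF span_base[OF insertI1]])
    then show "insert x S \<subseteq> span (insert y S)"
      using span_superset[of "insert y S"] by auto
  qed
  have "y - x \<in> span S"
    using span_neg[OF assms] by simp
  show ?thesis
    using le[OF assms] le[OF \<open>y - x \<in> span S\<close>] by (rule subset_antisym)
qed

lemma card_image_le_if_factors:
  assumes "finite (g ` A)" and factors: "\<And>x y. x \<in> A \<Longrightarrow> y \<in> A \<Longrightarrow> g x = g y \<Longrightarrow> f x = f y"
  shows "finite (f ` A)" "card (f ` A) \<le> card (g ` A)"
proof -
  have sub: "f ` A \<subseteq> (\<lambda>u. f (inv_into A g u)) ` g ` A"
  proof
    fix z assume "z \<in> f ` A"
    then obtain x where x: "x \<in> A" "z = f x"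
      by blast
    have "inv_into A g (g x) \<in> A" "g (inv_into A g (g x)) = g x"
      using x(1) by (auto intro: inv_into_into f_inv_into_f)
    then have "z = f (inv_into A g (g x))"
      using factors x by metis
    with x(1) show "z \<in> (\<lambda>u. f (inv_into A g u)) ` g ` A"
      by blast
  qed
  have fin: "finite ((\<lambda>u. f (inv_into A g u)) ` g ` A)"
    using assms(1) by simp
  with sub show "finite (f ` A)"
    by (rule finite_subset)
  have "card (f ` A) \<le> card ((\<lambda>u. f (inv_into A g u)) ` g ` A)"
    using fin sub by (rule card_mono)
  also have "\<dots> \<le> card (g ` A)"
    using assms(1) by (rule card_image_le)
  finally show "card (f ` A) \<le> card (g ` A)" .
qed

lemma card_int_interval_le:
  fixes R :: real
  assumes "R \<ge> 0"
  shows "real (card {\<lfloor>- R\<rfloor>..\<lfloor>R\<rfloor>}) \<le> 2 * R + 2"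
proof -
  have "\<lfloor>R\<rfloor> - \<lfloor>- R\<rfloor> + 1 \<ge> 0"
    using assms floor_mono[of "- R" R] by linarith
  then have "real (card {\<lfloor>- R\<rfloor>..\<lfloor>R\<rfloor>}) = of_int \<lfloor>R\<rfloor> - of_int \<lfloor>- R\<rfloor> + 1"
    by simp
  also have "\<dots> \<le> 2 * R + 2"
    using of_int_floor_le[of R] real_of_int_floor_add_one_gt[of "- R"] by linarith
  finally show ?thesis .
qed

section \<open>Lattices\<close>

lemma lattice_integral_coordinates:
  fixes L :: "'a::euclidean_space set"
  assumes "is_lattice L"
  obtains B where "independent B" "finite B" "span B = UNIV"
    "L = {x. \<forall>b\<in>B. representation B x b \<in> \<int>}"
proof -
  obtain B where B: "independent B" "card B = DIM('a)"
    and L: "L = {x. \<exists>c. (\<forall>b\<in>B. c b \<in> \<int>) \<and> x = (\<Sum>b\<in>B. c b *\<^sub>R b)}"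
    using assms unfolding is_lattice_def by blast
  have fin: "finite B"
    using B(2) card_ge_0_finite by force
  have span: "span B = UNIV"
    using B dim_eq_full dim_eq_card_independent by metis
  have "representation B (\<Sum>b\<in>B. c b *\<^sub>R b) b = c b" if "b \<in> B" for c b
  proof -
    have "representation B (\<Sum>b\<in>B. c b *\<^sub>R b) = (\<lambda>b. if b \<in> B then c b else 0)"
      by (rule representation_eqI[OF B(1)])
        (auto simp: span fin intro!: sum.mono_neutral_cong_left split: if_splits)
    with that show ?thesis by simp
  qed
  moreover have "x = (\<Sum>b\<in>B. representation B x b *\<^sub>R b)" for x
    using sum_representation_eq[OF B(1) _ fin, of x] by (simp add: span)
  ultimately have "L = {x. \<forall>b\<in>B. representation B x b \<in> \<int>}"
    unfolding L by (intro Collect_cong iffI) (metis, blast)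
  with B(1) fin span show thesis by (rule that)
qed

locale full_lattice =
  fixes L :: "'a::euclidean_space set"
  assumes is_lattice: "is_lattice L"
begin

lemma lattice_diff: "x \<in> L \<Longrightarrow> y \<in> L \<Longrightarrow> x - y \<in> L"
  by (rule lattice_integral_coordinates[OF is_lattice])
    (auto simp: representation_diff)

lemma lattice_add: "x \<in> L \<Longrightarrow> y \<in> L \<Longrightarrow> x + y \<in> L"
  by (rule lattice_integral_coordinates[OF is_lattice])
    (auto simp: representation_add)

lemma lattice_scaleR_Ints: "r \<in> \<int> \<Longrightarrow> x \<in> L \<Longrightarrow> r *\<^sub>R x \<in> L"
  by (rule lattice_integral_coordinates[OF is_lattice])
    (auto simp: representation_scale)

lemma lattice_zero: "0 \<in> L"
  by (rule lattice_integral_coordinates[OF is_lattice]) (auto simp: representation_zero)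

lemma lattice_sum: "(\<And>i. i \<in> I \<Longrightarrow> f i \<in> L) \<Longrightarrow> sum f I \<in> L"
  by (induction I rule: infinite_finite_induct) (auto simp: lattice_zero lattice_add)

lemma span_lattice: "span L = UNIV"
proof -
  obtain B where B: "independent B" "span B = UNIV"
    and L: "L = {x. \<forall>b\<in>B. representation B x b \<in> \<int>}"
    by (rule lattice_integral_coordinates[OF is_lattice])
  have "B \<subseteq> L"
    unfolding L by (auto simp: representation_basis[OF B(1)])
  then show ?thesis
    using span_mono B(2) by blast
qed

lemma lattice_discrete: "\<exists>\<delta>>0. \<forall>x\<in>L. x \<noteq> 0 \<longrightarrow> \<delta> \<le> norm x"
proof -
  obtain B where B: "independent B" "finite B" "span B = UNIV"
    and L: "L = {x. \<forall>b\<in>B. representation B x b \<in> \<int>}"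
    by (rule lattice_integral_coordinates[OF is_lattice])
  have "linear (\<lambda>x. representation B x b)" for b
    by (rule linearI) (simp_all add: representation_add representation_scale B)
  then have "\<exists>M>0. \<forall>x. \<bar>representation B x b\<bar> \<le> M * norm x" for b
    by (metis linear_bounded_pos real_norm_def)
  then obtain M where M: "\<And>b. M b > 0" "\<And>b x. \<bar>representation B x b\<bar> \<le> M b * norm x"
    by metis
  define M0 where "M0 = (\<Sum>b\<in>B. M b)"
  have "1 \<le> M0 * norm x" if x: "x \<in> L" "x \<noteq> 0" for x
  proof -
    have x_sum: "x = (\<Sum>b\<in>B. representation B x b *\<^sub>R b)"
      using sum_representation_eq[OF B(1) _ B(2), of x] B(3) by simp
    have "\<exists>b\<in>B. representation B x b \<noteq> 0"
    proof (rule ccontr)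
      assume "\<not> ?thesis"
      then have "x = 0"
        by (subst x_sum) (auto intro: sum.neutral)
      with x(2) show False
        by simp
    qed
    then obtain b where b: "b \<in> B" "representation B x b \<noteq> 0" ..
    have "1 \<le> \<bar>representation B x b\<bar>"
      using x(1) b unfolding L by (auto elim!: Ints_cases)
    also have "\<dots> \<le> M b * norm x"
      by (rule M(2))
    also have "\<dots> \<le> M0 * norm x"
      unfolding M0_def using b(1) B(2) M(1)
      by (intro mult_right_mono member_le_sum) (auto intro: less_imp_le)
    finally show ?thesis .
  qed
  moreover have "M0 > 0"
  proof -
    have "B \<noteq> {}"
      using B(3) dim_UNIV[where 'a='a] by (metis DIM_positive dim_span dim_empty less_irrefl)
    then show ?thesis
      unfolding M0_def using B(2) M(1) by (intro sum_pos) auto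
  qed
  ultimately show ?thesis
    by (intro exI[of _ "1 / M0"]) (auto simp: field_simps)
qed

section \<open>Successive minima of the unit ball\<close>

definition radii :: "nat \<Rightarrow> real set" where
  "radii i = {t. t > 0 \<and> i \<le> dim (L \<inter> cball 0 t)}"

abbreviation lam :: "nat \<Rightarrow> real" where
  "lam i \<equiv> succ_min L (cball 0 1) i"

lemma lam_eq_Inf_radii: "lam i = Inf (radii i)"
  unfolding succ_min_def radii_def by (auto simp: scaleR_image_cball_0 intro!: arg_cong[of _ _ Inf])

lemma lam_le: "t \<in> radii i \<Longrightarrow> lam i \<le> t"
  unfolding lam_eq_Inf_radii by (rule cInf_lower) (auto simp: radii_def intro: bdd_belowI[of _ 0])

lemma lam_mono: "i \<le> j \<Longrightarrow> radii j \<noteq> {} \<Longrightarrow> lam i \<le> lam j"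
  unfolding lam_eq_Inf_radii
  by (rule cInf_superset_mono) (auto simp: radii_def intro: bdd_belowI[of _ 0])

lemma lam_pos:
  assumes "1 \<le> i" "radii i \<noteq> {}"
  shows "lam i > 0"
proof -
  obtain \<delta> where \<delta>: "\<delta> > 0" "\<And>x. x \<in> L \<Longrightarrow> x \<noteq> 0 \<Longrightarrow> \<delta> \<le> norm x"
    using lattice_discrete by blast
  have "\<delta> \<le> t" if t: "t \<in> radii i" for t
  proof -
    have "\<not> L \<inter> cball 0 t \<subseteq> {0}"
    proof
      assume "L \<inter> cball 0 t \<subseteq> {0}"
      then have "dim (L \<inter> cball 0 t) = 0"
        by simp
      with t assms(1) show False
        by (simp add: radii_def)
    qed
    then obtain x where "x \<in> L" "x \<noteq> 0" "norm x \<le> t"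
      by (auto simp: subset_iff)
    then show ?thesis
      using \<delta>(2) by force
  qed
  then have "\<delta> \<le> lam i"
    unfolding lam_eq_Inf_radii using assms(2) by (intro cInf_greatest)
  with \<delta>(1) show ?thesis
    by simp
qed

section \<open>A greedy basis of almost shortest lattice vectors\<close>

text \<open>Asking only for a length within a factor 2 of the infimum avoids proving that the
  infimum over \<open>L - span S\<close> is attained.\<close>

definition almost_shortest :: "'a set \<Rightarrow> 'a \<Rightarrow> bool" where
  "almost_shortest S w \<longleftrightarrow>
     w \<in> L \<and> w \<notin> span S \<and> (\<forall>w'\<in>L. w' \<notin> span S \<longrightarrow> norm w \<le> 2 * norm w')"

lemma almost_shortest_exists:
  assumes "span S \<noteq> UNIV"
  shows "\<exists>w. almost_shortest S w"
proof -
  obtain \<delta> where \<delta>: "\<delta> > 0" "\<And>x. x \<in> L \<Longrightarrow> x \<noteq> 0 \<Longrightarrow> \<delta> \<le> norm x"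
    using lattice_discrete by blast
  have "\<not> L \<subseteq> span S"
    using span_lattice assms span_minimal[of L "span S"] by auto
  then have ne: "norm ` (L - span S) \<noteq> {}"
    by blast
  define m where "m = Inf (norm ` (L - span S))"
  have m_le: "m \<le> norm w" if "w \<in> L" "w \<notin> span S" for w
    unfolding m_def using that by (intro cInf_lower) (auto intro: bdd_belowI[of _ 0])
  have "\<delta> \<le> m"
    unfolding m_def using ne \<delta>(2) span_zero by (intro cInf_greatest) force+
  then have "m < 2 * m"
    using \<delta>(1) by linarith
  then obtain w where w: "w \<in> L" "w \<notin> span S" "norm w < 2 * m"
    using cInf_lessD[OF ne] unfolding m_def by blast
  have "norm w \<le> 2 * norm w'" if "w' \<in> L" "w' \<notin> span S" for w'
    using m_le[OF that] w(3) by linarith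
  with w show ?thesis
    unfolding almost_shortest_def by blast
qed

primrec greedy_prefix :: "nat \<Rightarrow> 'a set" where
  "greedy_prefix 0 = {}"
| "greedy_prefix (Suc j) = insert (SOME w. almost_shortest (greedy_prefix j) w) (greedy_prefix j)"

definition v :: "nat \<Rightarrow> 'a" where
  "v j = (SOME w. almost_shortest (greedy_prefix j) w)"

lemma greedy_prefix_eq: "greedy_prefix j = v ` {..<j}"
  by (induction j) (auto simp: v_def lessThan_Suc)

abbreviation U :: "nat \<Rightarrow> 'a set" where
  "U j \<equiv> span (v ` {..<j})"

lemma greedy_vectors:
  "j \<le> DIM('a) \<Longrightarrow>
     (\<forall>i<j. almost_shortest (v ` {..<i}) (v i)) \<and> independent (v ` {..<j}) \<and> inj_on v {..<j}"
proof (induction j)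
  case (Suc j)
  then have IH: "\<forall>i<j. almost_shortest (v ` {..<i}) (v i)" "independent (v ` {..<j})"
      "inj_on v {..<j}"
    by auto
  have "dim (v ` {..<j}) = j"
    using IH(2,3) by (simp add: dim_eq_card_independent card_image)
  then have "U j \<noteq> UNIV"
    using Suc.prems dim_eq_full by (metis Suc_n_not_le_n)
  then have new: "almost_shortest (v ` {..<j}) (v j)"
    unfolding v_def greedy_prefix_eq[symmetric]
    by (rule someI_ex[OF almost_shortest_exists[unfolded greedy_prefix_eq[symmetric]]])
  then have "v j \<notin> U j"
    by (simp add: almost_shortest_def)
  then show ?case
    using IH new span_base[of "v j" "v ` {..<j}"]
    by (auto simp: lessThan_Suc less_Suc_eq independent_insert)
qed (simp add: independent_empty)

lemma v_almost_shortest: "i < DIM('a) \<Longrightarrow> almost_shortest (v ` {..<i}) (v i)"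
  using greedy_vectors[of "DIM('a)"] by simp

lemma independent_v: "independent (v ` {..<DIM('a)})"
  using greedy_vectors[of "DIM('a)"] by simp

lemma inj_on_v: "inj_on v {..<DIM('a)}"
  using greedy_vectors[of "DIM('a)"] by simp

lemma v_in_lattice: "i < DIM('a) \<Longrightarrow> v i \<in> L"
  using v_almost_shortest by (simp add: almost_shortest_def)

lemma v_notin_U: "i < DIM('a) \<Longrightarrow> v i \<notin> U i"
  using v_almost_shortest by (simp add: almost_shortest_def)

lemma norm_v_le: "i < DIM('a) \<Longrightarrow> w \<in> L \<Longrightarrow> w \<notin> U i \<Longrightarrow> norm (v i) \<le> 2 * norm w"
  using v_almost_shortest by (simp add: almost_shortest_def)

lemma v_nonzero: "i < DIM('a) \<Longrightarrow> v i \<noteq> 0"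
  using v_notin_U span_zero by metis

lemma U_mono: "i \<le> j \<Longrightarrow> U i \<subseteq> U j"
  by (intro span_mono image_mono) auto

lemma norm_v_le_norm_v: "i \<le> j \<Longrightarrow> j < DIM('a) \<Longrightarrow> norm (v i) \<le> 2 * norm (v j)"
  using norm_v_le[of i "v j"] v_in_lattice v_notin_U U_mono[of i j]
  by (cases "i = j") auto

lemma U_DIM: "U DIM('a) = UNIV"
  using independent_v inj_on_v dim_eq_full
  by (metis card_image card_lessThan dim_eq_card_independent)

lemma two_norm_v_in_radii:
  assumes "j < DIM('a)"
  shows "2 * norm (v j) \<in> radii (Suc j)"
proof -
  have "v ` {..<Suc j} \<subseteq> L \<inter> cball 0 (2 * norm (v j))"
    using assms v_in_lattice norm_v_le_norm_v by auto
  moreover have "independent (v ` {..<Suc j})"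
    using assms by (intro independent_mono[OF independent_v] image_mono) auto
  moreover have "card (v ` {..<Suc j}) = Suc j"
    using assms inj_on_subset[OF inj_on_v] by (simp add: card_image)
  ultimately have "Suc j \<le> dim (L \<inter> cball 0 (2 * norm (v j)))"
    using independent_card_le_dim by metis
  then show ?thesis
    using v_nonzero[OF assms] by (simp add: radii_def)
qed

lemma lam_Suc_pos: "j < DIM('a) \<Longrightarrow> lam (Suc j) > 0"
  using two_norm_v_in_radii[of j] by (intro lam_pos) auto

lemma lam_Suc_le_norm_v: "j < DIM('a) \<Longrightarrow> lam (Suc j) \<le> 2 * norm (v j)"
  by (rule lam_le[OF two_norm_v_in_radii])

lemma lam_le_lam_DIM:
  assumes "i \<le> DIM('a)"
  shows "lam i \<le> lam DIM('a)"
proof (rule lam_mono[OF assms])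
  have "2 * norm (v (DIM('a) - 1)) \<in> radii (Suc (DIM('a) - 1))"
    by (rule two_norm_v_in_radii) simp
  then show "radii DIM('a) \<noteq> {}"
    by auto
qed

section \<open>Coordinates with respect to the greedy basis\<close>

definition coord :: "nat \<Rightarrow> 'a \<Rightarrow> real" where
  "coord j x = representation (v ` {..<DIM('a)}) x (v j)"

lemma sum_coord: "(\<Sum>i<DIM('a). coord i x *\<^sub>R v i) = x"
proof -
  have "(\<Sum>b\<in>v ` {..<DIM('a)}. representation (v ` {..<DIM('a)}) x b *\<^sub>R b) = x"
    by (rule sum_representation_eq) (auto simp: independent_v U_DIM)
  then show ?thesis
    unfolding coord_def by (simp add: sum.reindex[OF inj_on_v])
qed

lemma coord_diff: "coord j (x - y) = coord j x - coord j y"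
  unfolding coord_def by (simp add: representation_diff independent_v U_DIM)

lemma coord_eq_0_if_in_U:
  assumes "x \<in> U i" "i \<le> j" "j < DIM('a)"
  shows "coord j x = 0"
proof -
  have "coord j x = representation (v ` {..<i}) x (v j)"
    unfolding coord_def using assms
    by (intro fun_cong[OF representation_extend[OF independent_v]]) auto
  moreover have "v j \<notin> v ` {..<i}"
    using assms(2,3) inj_on_v by (auto simp: inj_on_eq_iff)
  ultimately show ?thesis
    using representation_ne_zero by metis
qed

definition proj :: "nat \<Rightarrow> 'a \<Rightarrow> 'a" where
  "proj i x = (\<Sum>l<i. coord l x *\<^sub>R v l)"

lemma proj_in_U: "proj i x \<in> U i"
  unfolding proj_def by (intro span_sum span_scale span_base) auto

lemma proj_Suc: "proj (Suc i) x = proj i x + coord i x *\<^sub>R v i"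
  unfolding proj_def by simp

lemma proj_eq_self:
  assumes "i \<le> DIM('a)" "\<And>j. i \<le> j \<Longrightarrow> j < DIM('a) \<Longrightarrow> coord j x = 0"
  shows "proj i x = x"
  using assms
proof (induction i rule: inc_induct)
  case base
  show ?case
    using sum_coord by (simp add: proj_def)
qed (simp add: proj_Suc)

lemma proj_eq_self_if_in_U: "p \<in> U i \<Longrightarrow> i \<le> DIM('a) \<Longrightarrow> proj i p = p"
  by (auto intro: proj_eq_self coord_eq_0_if_in_U)

end

section \<open>Lattice points far from the subspaces \<open>U j\<close>\<close>

text \<open>In \<open>lattice_far_from_U\<close>, \<open>|v j| \<le> 2 |q w - u| \<le> 2 q |w - p| + |v j| / 2\<close> with
  \<open>q \<le> (8d)\<^sup>d\<close>.\<close>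

definition sep_const :: "nat \<Rightarrow> real" where
  "sep_const d = 1 / (4 * real (8 * d) ^ d)"

lemma sep_const_pos: "sep_const d > 0"
  unfolding sep_const_def by (cases d) auto

context full_lattice
begin

lemma lattice_point_near_multiple:
  assumes j: "j < DIM('a)" and p: "p \<in> U j"
  obtains q u where "0 < q" "q \<le> int ((8 * DIM('a)) ^ j)" "u \<in> L" "u \<in> U j"
    "norm (of_int q *\<^sub>R p - u) \<le> norm (v j) / 4"
proof -
  define d where "d = DIM('a)"
  define t where "t i = coord i p" for i
  have p_sum: "p = (\<Sum>i<j. t i *\<^sub>R v i)"
    using proj_eq_self_if_in_U[OF p] j unfolding proj_def t_def by simp
  have "8 * d > 0"
    by (simp add: d_def)
  then obtain q r where q: "0 < q" "q \<le> int ((8 * d) ^ j)"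
    and r: "\<And>i. i < j \<Longrightarrow> \<bar>of_int q * t i - of_int (r i)\<bar> < 1 / real (8 * d)"
    by (rule Dirichlet_approx_simult[where \<theta>=t and n=j]) blast
  define u where "u = (\<Sum>i<j. of_int (r i) *\<^sub>R v i)"
  have u: "u \<in> L" "u \<in> U j"
    unfolding u_def using j
    by (auto intro!: lattice_sum lattice_scaleR_Ints v_in_lattice)
      (intro span_sum span_scale span_base, auto)
  have "of_int q *\<^sub>R p - u = (\<Sum>i<j. (of_int q * t i - of_int (r i)) *\<^sub>R v i)"
    unfolding p_sum u_def by (simp add: scaleR_sum_right scaleR_diff_left sum_subtractf)
  then have "norm (of_int q *\<^sub>R p - u) \<le> (\<Sum>i<j. \<bar>of_int q * t i - of_int (r i)\<bar> * norm (v i))"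
    using norm_sum[of "\<lambda>i. (of_int q * t i - of_int (r i)) *\<^sub>R v i" "{..<j}"] by simp
  also have "\<dots> \<le> (\<Sum>i<j. 1 / real (8 * d) * (2 * norm (v j)))"
  proof (rule sum_mono)
    fix i assume "i \<in> {..<j}"
    then show "\<bar>of_int q * t i - of_int (r i)\<bar> * norm (v i) \<le> 1 / real (8 * d) * (2 * norm (v j))"
      using r[of i] norm_v_le_norm_v[of i j] j by (intro mult_mono) simp_all
  qed
  also have "\<dots> = real j / real d * (norm (v j) / 4)"
    by (simp add: d_def)
  also have "\<dots> \<le> norm (v j) / 4"
    using j by (intro mult_left_le_one_le) (auto simp: d_def)
  finally show thesis
    using that q u unfolding d_def by blast
qed

lemma lattice_far_from_U:
  assumes j: "j < DIM('a)" and w: "w \<in> L" "w \<notin> U j" and p: "p \<in> U j"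
  shows "sep_const DIM('a) * norm (v j) \<le> norm (w - p)"
proof -
  obtain q u where q: "0 < q" "q \<le> int ((8 * DIM('a)) ^ j)" and u: "u \<in> L" "u \<in> U j"
    and qp_u: "norm (of_int q *\<^sub>R p - u) \<le> norm (v j) / 4"
    using lattice_point_near_multiple[OF j p] .
  define z where "z = of_int q *\<^sub>R w - u"
  have "z \<in> L"
    unfolding z_def using w u by (intro lattice_diff lattice_scaleR_Ints) auto
  moreover have "z \<notin> U j"
  proof
    assume "z \<in> U j"
    then have "of_int q *\<^sub>R w \<in> U j"
      using u unfolding z_def by (metis diff_add_cancel span_add)
    then have "inverse (of_int q) *\<^sub>R of_int q *\<^sub>R w \<in> U j"
      by (rule span_scale)
    with q(1) w(2) show False
      by simp
  qed
  ultimately have "norm (v j) \<le> 2 * norm z"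
    by (rule norm_v_le[OF j])
  moreover have "norm z \<le> of_int q * norm (w - p) + norm (v j) / 4"
  proof -
    have "z = of_int q *\<^sub>R (w - p) + (of_int q *\<^sub>R p - u)"
      unfolding z_def by (simp add: scaleR_diff_right)
    then show ?thesis
      using norm_triangle_ineq[of "of_int q *\<^sub>R (w - p)" "of_int q *\<^sub>R p - u"] qp_u q(1)
      by simp
  qed
  ultimately have "norm (v j) \<le> 4 * of_int q * norm (w - p)"
    by linarith
  also have "\<dots> \<le> 4 * real (8 * DIM('a)) ^ DIM('a) * norm (w - p)"
  proof -
    have "of_int q \<le> real (8 * DIM('a)) ^ j"
      using q(2) by (metis of_int_le_iff of_int_of_nat_eq of_nat_power)
    also have "\<dots> \<le> real (8 * DIM('a)) ^ DIM('a)"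
      using j by (intro power_increasing) auto
    finally show ?thesis
      by (simp add: mult_right_mono)
  qed
  finally show ?thesis
    unfolding sep_const_def by (simp add: field_simps)
qed

lemma sep_const_abs_coord_le:
  assumes j: "j < DIM('a)"
  shows "sep_const DIM('a) * (\<bar>coord j x\<bar> * norm (v j)) \<le> norm (proj (Suc j) x)"
proof (cases "coord j x = 0")
  case False
  have "- ((1 / coord j x) *\<^sub>R proj j x) \<in> U j"
    by (intro span_neg span_scale proj_in_U)
  from lattice_far_from_U[OF j v_in_lattice[OF j] v_notin_U[OF j] this]
  have "sep_const DIM('a) * norm (v j) \<le> norm (v j + (1 / coord j x) *\<^sub>R proj j x)"
    by simp
  then have "\<bar>coord j x\<bar> * (sep_const DIM('a) * norm (v j))
      \<le> \<bar>coord j x\<bar> * norm (v j + (1 / coord j x) *\<^sub>R proj j x)"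
    by (rule mult_left_mono) simp
  also have "\<dots> = norm (coord j x *\<^sub>R (v j + (1 / coord j x) *\<^sub>R proj j x))"
    by simp
  also have "coord j x *\<^sub>R (v j + (1 / coord j x) *\<^sub>R proj j x) = proj (Suc j) x"
    using False by (simp add: proj_Suc scaleR_add_right add.commute)
  finally show ?thesis
    by (simp add: ac_simps)
qed simp

lemma norm_proj_le:
  assumes "j \<le> DIM('a)"
  shows "norm (proj j x) \<le> (1 + 1 / sep_const DIM('a)) ^ (DIM('a) - j) * norm x"
  using assms
proof (induction j rule: inc_induct)
  case base
  show ?case
    by (simp add: proj_eq_self)
next
  case (step n)
  define c where "c = sep_const DIM('a)"
  have c: "c > 0"
    unfolding c_def by (rule sep_const_pos)
  have "norm (proj n x) \<le> norm (proj (Suc n) x) + \<bar>coord n x\<bar> * norm (v n)"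
    using norm_triangle_ineq4[of "proj (Suc n) x" "coord n x *\<^sub>R v n"] by (simp add: proj_Suc)
  also have "\<bar>coord n x\<bar> * norm (v n) \<le> norm (proj (Suc n) x) / c"
    using sep_const_abs_coord_le[OF step(2), of x] c by (simp add: c_def field_simps)
  also have "norm (proj (Suc n) x) + norm (proj (Suc n) x) / c = (1 + 1 / c) * norm (proj (Suc n) x)"
    by (simp add: field_simps)
  also have "\<dots> \<le> (1 + 1 / c) * ((1 + 1 / c) ^ (DIM('a) - Suc n) * norm x)"
    using step(3) c unfolding c_def by (intro mult_left_mono) auto
  also have "\<dots> = (1 + 1 / c) ^ (DIM('a) - n) * norm x"
    using step(2) by (simp add: Suc_diff_Suc flip: power_Suc)
  finally show ?case
    unfolding c_def by simp
qed

text \<open>Downward induction: once the coordinates above \<open>n\<close> agree, \<open>x - y\<close> lies at distance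
  \<open>|coord n (x - y)| |v n|\<close> from \<open>U n\<close>, and \<open>lattice_far_from_U\<close> forbids this to be
  positive but below \<open>sep_const DIM('a) |v n|\<close>.\<close>

lemma coord_eq_if_close:
  assumes xy: "x \<in> L" "y \<in> L" and "i \<le> DIM('a)"
    and close: "\<And>j. i \<le> j \<Longrightarrow> j < DIM('a) \<Longrightarrow> \<bar>coord j x - coord j y\<bar> < sep_const DIM('a)"
  shows "\<forall>j. i \<le> j \<and> j < DIM('a) \<longrightarrow> coord j x = coord j y"
  using assms(3)
proof (induction i rule: inc_induct)
  case (step n)
  define z where "z = x - y"
  have "coord n z = 0"
  proof (rule ccontr)
    assume nz: "coord n z \<noteq> 0"
    have "proj (Suc n) z = z"
      using step(2,3) by (intro proj_eq_self) (auto simp: z_def coord_diff)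
    then have z_rest: "z - proj n z = coord n z *\<^sub>R v n"
      by (metis proj_Suc add_diff_cancel_left')
    have "z \<in> L"
      unfolding z_def using xy by (rule lattice_diff)
    moreover have "z \<notin> U n"
      using nz coord_eq_0_if_in_U step(2) by blast
    ultimately have "sep_const DIM('a) * norm (v n) \<le> norm (z - proj n z)"
      by (rule lattice_far_from_U[OF step(2) _ _ proj_in_U])
    then have "sep_const DIM('a) * norm (v n) \<le> \<bar>coord n z\<bar> * norm (v n)"
      by (simp add: z_rest)
    then show False
      using close[of n] step(1,2) v_nonzero[of n] by (simp add: z_def coord_diff)
  qed
  then have "coord n x = coord n y"
    by (simp add: z_def coord_diff)
  with step(3) show ?case
    by (metis Suc_leI le_neq_implies_less)
qed simp

end

definition coord_const :: "nat \<Rightarrow> real" where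
  "coord_const d = (1 + 1 / sep_const d) ^ d / sep_const d"

lemma coord_const_pos: "coord_const d > 0"
  unfolding coord_const_def using sep_const_pos[of d] by (simp add: add_pos_pos)

context full_lattice
begin

lemma abs_coord_le:
  assumes j: "j < DIM('a)"
  shows "\<bar>coord j x\<bar> * norm (v j) \<le> coord_const DIM('a) * norm x"
proof -
  define c where "c = sep_const DIM('a)"
  have c: "c > 0"
    unfolding c_def by (rule sep_const_pos)
  have "\<bar>coord j x\<bar> * norm (v j) \<le> norm (proj (Suc j) x) / c"
    using sep_const_abs_coord_le[OF j, of x] c by (simp add: c_def field_simps)
  also have "\<dots> \<le> (1 + 1 / c) ^ (DIM('a) - Suc j) * norm x / c"
    using norm_proj_le[of "Suc j" x] j c by (simp add: c_def divide_right_mono)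
  also have "\<dots> \<le> (1 + 1 / c) ^ DIM('a) * norm x / c"
    using c by (intro divide_right_mono mult_right_mono power_increasing) auto
  finally show ?thesis
    unfolding coord_const_def c_def by simp
qed

lemma abs_coord_le_lam:
  assumes "norm x \<le> 1" "j < DIM('a)"
  shows "\<bar>coord j x\<bar> \<le> 2 * coord_const DIM('a) / lam (Suc j)"
proof -
  have "\<bar>coord j x\<bar> * lam (Suc j) \<le> \<bar>coord j x\<bar> * (2 * norm (v j))"
    using lam_Suc_le_norm_v[OF assms(2)] by (rule mult_left_mono) simp
  also have "\<dots> = 2 * (\<bar>coord j x\<bar> * norm (v j))"
    by simp
  also have "\<dots> \<le> 2 * (coord_const DIM('a) * norm x)"
    using abs_coord_le[OF assms(2)] by simp
  also have "\<dots> \<le> 2 * coord_const DIM('a)"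
    using assms(1) coord_const_pos[of "DIM('a)"] by (simp add: mult_left_le)
  finally show ?thesis
    using lam_Suc_pos[OF assms(2)] by (simp add: pos_le_divide_eq)
qed

section \<open>Covering by \<open>k\<close>-dimensional subspaces\<close>

text \<open>If \<open>x\<close> already lies in \<open>U i\<close>, the vector \<open>v i\<close> is added instead, so that the
  dimension is always \<open>i + 1\<close>.\<close>

definition cover_space :: "nat \<Rightarrow> 'a \<Rightarrow> 'a set" where
  "cover_space i x = span (insert (if x \<in> U i then v i else x) (v ` {..<i}))"

lemma dim_cover_space:
  assumes "i < DIM('a)"
  shows "dim (cover_space i x) = Suc i"
proof -
  define w where "w = (if x \<in> U i then v i else x)"
  have w: "w \<notin> U i"
    unfolding w_def using v_notin_U[OF assms] by auto
  have "independent (v ` {..<i})"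
    using assms by (intro independent_mono[OF independent_v] image_mono) auto
  with w have ind: "independent (insert w (v ` {..<i}))"
    by (simp add: independent_insert)
  have card: "card (insert w (v ` {..<i})) = Suc i"
  proof -
    have "w \<notin> v ` {..<i}"
      using w span_base[of w "v ` {..<i}"] by blast
    moreover have "card (v ` {..<i}) = i"
      using assms inj_on_subset[OF inj_on_v, of "{..<i}"] by (simp add: card_image)
    ultimately show ?thesis
      by simp
  qed
  have "dim (span (insert w (v ` {..<i}))) = Suc i"
    by (rule trans[OF dim_span_eq_card_independent[OF ind] card])
  then show ?thesis
    by (simp only: cover_space_def w_def)
qed

lemma in_cover_space: "x \<in> cover_space i x"
proof (cases "x \<in> U i")
  case True
  then show ?thesis
    unfolding cover_space_def using span_mono[OF subset_insertI] by auto
qed (simp add: cover_space_def span_base)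

lemma cover_space_eq:
  assumes "i \<le> DIM('a)" "\<forall>j. i \<le> j \<and> j < DIM('a) \<longrightarrow> coord j x = coord j y"
  shows "cover_space i x = cover_space i y"
proof -
  have "proj i (x - y) = x - y"
    using assms by (intro proj_eq_self) (auto simp: coord_diff)
  then have "x - y \<in> U i"
    by (metis proj_in_U)
  then have "x \<in> U i \<longleftrightarrow> y \<in> U i"
    using span_diff[of x _ "x - y"] span_add[of y _ "x - y"] by auto
  then show ?thesis
    unfolding cover_space_def using span_insert_eq_if_diff_in_span[OF \<open>x - y \<in> U i\<close>] by auto
qed

definition cell :: "nat \<Rightarrow> 'a \<Rightarrow> nat \<Rightarrow> int" where
  "cell i x = (\<lambda>j\<in>{i..<DIM('a)}. \<lfloor>coord j x / sep_const DIM('a)\<rfloor>)"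

lemma cover_space_eq_if_cell_eq:
  assumes "x \<in> L" "y \<in> L" "i \<le> DIM('a)" "cell i x = cell i y"
  shows "cover_space i x = cover_space i y"
proof (rule cover_space_eq[OF assms(3) coord_eq_if_close[OF assms(1-3)]])
  fix j assume j: "i \<le> j" "j < DIM('a)"
  then have "\<lfloor>coord j x / sep_const DIM('a)\<rfloor> = \<lfloor>coord j y / sep_const DIM('a)\<rfloor>"
    using fun_cong[OF assms(4), of j] by (simp add: cell_def)
  then have "\<bar>coord j x / sep_const DIM('a) - coord j y / sep_const DIM('a)\<bar> < 1"
    by (rule floor_eq_imp_diff_1)
  then have "\<bar>coord j x - coord j y\<bar> / sep_const DIM('a) < 1"
    using sep_const_pos[of "DIM('a)"] by (simp flip: diff_divide_distrib)
  then show "\<bar>coord j x - coord j y\<bar> < sep_const DIM('a)"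
    using sep_const_pos[of "DIM('a)"] by (simp add: divide_less_eq)
qed

definition cell_radius :: "nat \<Rightarrow> real" where
  "cell_radius j = 2 * coord_const DIM('a) / (sep_const DIM('a) * lam (Suc j))"

definition cell_box :: "nat \<Rightarrow> (nat \<Rightarrow> int) set" where
  "cell_box i = (\<Pi>\<^sub>E j\<in>{i..<DIM('a)}. {\<lfloor>- cell_radius j\<rfloor>..\<lfloor>cell_radius j\<rfloor>})"

lemma cell_in_box:
  assumes "norm x \<le> 1"
  shows "cell i x \<in> cell_box i"
proof -
  have "\<lfloor>coord j x / sep_const DIM('a)\<rfloor> \<in> {\<lfloor>- cell_radius j\<rfloor>..\<lfloor>cell_radius j\<rfloor>}"
    if j: "j < DIM('a)" for j
  proof -
    have c: "sep_const DIM('a) > 0"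
      by (rule sep_const_pos)
    have "\<bar>coord j x / sep_const DIM('a)\<bar> = \<bar>coord j x\<bar> / sep_const DIM('a)"
      using c by simp
    also have "\<dots> \<le> 2 * coord_const DIM('a) / lam (Suc j) / sep_const DIM('a)"
      by (rule divide_right_mono[OF abs_coord_le_lam[OF assms j] less_imp_le[OF c]])
    also have "\<dots> = cell_radius j"
      by (simp add: cell_radius_def mult.commute)
    finally have "- cell_radius j \<le> coord j x / sep_const DIM('a)"
        "coord j x / sep_const DIM('a) \<le> cell_radius j"
      by (simp_all only: abs_le_iff) linarith+
    then show ?thesis
      by (auto intro: floor_mono)
  qed
  then show ?thesis
    by (simp add: cell_def cell_box_def restrict_PiE_iff)
qed

end

definition cover_factor :: "nat \<Rightarrow> real" where
  "cover_factor d = 4 * coord_const d / sep_const d + 2"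

context full_lattice
begin

lemma card_cell_interval_le:
  assumes "j < DIM('a)" "lam DIM('a) \<le> 1"
  shows "real (card {\<lfloor>- cell_radius j\<rfloor>..\<lfloor>cell_radius j\<rfloor>}) \<le> cover_factor DIM('a) / lam (Suc j)"
proof -
  define K where "K = 2 * coord_const DIM('a) / sep_const DIM('a)"
  have lam: "0 < lam (Suc j)" "lam (Suc j) \<le> 1"
    using assms lam_Suc_pos lam_le_lam_DIM[of "Suc j"] by auto
  have K: "K > 0"
    unfolding K_def using coord_const_pos sep_const_pos by simp
  have R: "cell_radius j = K / lam (Suc j)"
    unfolding cell_radius_def K_def by simp
  have "real (card {\<lfloor>- cell_radius j\<rfloor>..\<lfloor>cell_radius j\<rfloor>}) \<le> 2 * (K / lam (Suc j)) + 2"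
    unfolding R using K lam(1) by (intro card_int_interval_le) simp
  also have "\<dots> \<le> 2 * (K / lam (Suc j)) + 2 / lam (Suc j)"
    using lam by (simp add: field_simps)
  also have "\<dots> = cover_factor DIM('a) / lam (Suc j)"
    unfolding cover_factor_def K_def by (simp add: add_divide_distrib)
  finally show ?thesis .
qed

lemma card_cell_box_le:
  assumes "i < DIM('a)" "lam DIM('a) \<le> 1"
  shows "real (card (cell_box i))
    \<le> cover_factor DIM('a) ^ (DIM('a) - i) / (\<Prod>j=Suc i..DIM('a). lam j)"
proof -
  have "real (card (cell_box i))
      = (\<Prod>j=i..<DIM('a). real (card {\<lfloor>- cell_radius j\<rfloor>..\<lfloor>cell_radius j\<rfloor>}))"
    by (simp add: cell_box_def card_PiE)
  also have "\<dots> \<le> (\<Prod>j=i..<DIM('a). cover_factor DIM('a) / lam (Suc j))"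
    using card_cell_interval_le assms(2) by (intro prod_mono) auto
  also have "\<dots> = cover_factor DIM('a) ^ (DIM('a) - i) / (\<Prod>j=i..<DIM('a). lam (Suc j))"
    by (simp add: prod_dividef)
  also have "(\<Prod>j=i..<DIM('a). lam (Suc j)) = (\<Prod>j=Suc i..DIM('a). lam j)"
    by (simp add: prod.shift_bounds_Suc_ivl[symmetric] atLeastLessThanSuc_atLeastAtMost)
  finally show ?thesis .
qed

lemma lattice_points_covered:
  assumes k: "1 \<le> k" "k \<le> DIM('a)" and lam_DIM: "lam DIM('a) \<le> 1"
  shows "\<exists>F. finite F \<and> (\<forall>V\<in>F. subspace V \<and> dim V = k) \<and> L \<inter> cball 0 1 \<subseteq> \<Union>F \<and>
    real (card F) \<le> cover_factor DIM('a) ^ (DIM('a) - k + 1) / (\<Prod>j=k..DIM('a). lam j)"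
proof -
  define i where "i = k - 1"
  have i: "i < DIM('a)" "Suc i = k"
    using k by (auto simp: i_def)
  define B where "B = L \<inter> cball 0 1"
  have cells: "cell i ` B \<subseteq> cell_box i"
    unfolding B_def by (intro image_subsetI cell_in_box) simp
  have box: "finite (cell_box i)"
    unfolding cell_box_def by (simp add: finite_PiE)
  have factors: "cover_space i x = cover_space i y" if "x \<in> B" "y \<in> B" "cell i x = cell i y" for x y
    using that i(1) cover_space_eq_if_cell_eq by (auto simp: B_def)
  have "finite (cell i ` B)"
    using cells box by (rule finite_subset)
  note card_F = card_image_le_if_factors[where f = "cover_space i", OF this factors]
  have "real (card (cover_space i ` B)) \<le> real (card (cell_box i))"
    using card_F(2) card_mono[OF box cells] by linarith
  also have "\<dots> \<le> cover_factor DIM('a) ^ (DIM('a) - i) / (\<Prod>j=Suc i..DIM('a). lam j)"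
    by (rule card_cell_box_le[OF i(1) lam_DIM])
  also have "DIM('a) - i = DIM('a) - k + 1"
    using i by linarith
  finally have "real (card (cover_space i ` B))
      \<le> cover_factor DIM('a) ^ (DIM('a) - k + 1) / (\<Prod>j=k..DIM('a). lam j)"
    unfolding i(2) .
  moreover have "subspace V \<and> dim V = k" if "V \<in> cover_space i ` B" for V
    using that dim_cover_space[OF i(1)] i(2) by (auto simp: cover_space_def subspace_span)
  moreover have "L \<inter> cball 0 1 \<subseteq> \<Union> (cover_space i ` B)"
    unfolding B_def using in_cover_space by blast
  ultimately show ?thesis
    using card_F(1) by blast
qed

end

theorem corollary3:
  fixes k :: nat
  assumes "1 \<le> k" and "k \<le> DIM('a::euclidean_space) - 1"
  shows "\<exists>C::real. \<forall>L :: 'a set.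
           is_lattice L \<and> succ_min L (cball 0 1) DIM('a) \<le> 1 \<longrightarrow>
           (\<exists>F :: 'a set set. finite F \<and>
              (\<forall>V\<in>F. subspace V \<and> dim V = k) \<and>
              L \<inter> cball 0 1 \<subseteq> \<Union>F \<and>
              real (card F) \<le> C / (\<Prod>i=k..DIM('a). succ_min L (cball 0 1) i))"
proof (intro exI[of _ "cover_factor DIM('a) ^ (DIM('a) - k + 1)"] allI impI)
  fix L :: "'a set"
  assume L: "is_lattice L \<and> succ_min L (cball 0 1) DIM('a) \<le> 1"
  then interpret full_lattice L
    by unfold_locales simp
  show "\<exists>F. finite F \<and> (\<forall>V\<in>F. subspace V \<and> dim V = k) \<and> L \<inter> cball 0 1 \<subseteq> \<Union>F \<and>
      real (card F) \<le> cover_factor DIM('a) ^ (DIM('a) - k + 1) / (\<Prod>i=k..DIM('a). lam i)"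
    using lattice_points_covered assms L by simp
qed

end
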